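(* Let $n\ge 3$ and $1\le r\le n-2$ be integers with $n$ odd and $r$ even, and let $K_n$ be the complete graph on $n$ vertices. Then \[ \left\lfloor \frac{rn-1}{2}\right\rfloor-1\le cms_r(K_n)\le \left\lfloor \frac{rn-1}{2}\right\rfloor. \]
   Context: All graphs are simple. For an integer $N$, $[N]=\{0,1,\dots,N-1\}$. An ordering of a graph $G=(V,E)$ is a bijection $\ell:E\to[|E|]$; edges are cyclically consecutive in $\ell$ if their labels are consecutive integers modulo $|E|$. A graph is $(\le r)$-regular if every vertex has degree at most $r$. For an ordering $\ell$ of $G$, $cms_r(\ell)$ is the largest integer $s$ such that every $s$ cyclically consecutive edges of $\ell$ form a $(\le r)$-regular subgraph of $G$; $cms_r(G)$ is the maximum of $cms_r(\ell)$ over all orderings $\ell$ of $G$. *)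

theory Defs
  imports Complex_Main
begin

type_synonym 'a graph = "'a set \<times> 'a set set"

abbreviation verts :: "'a graph \<Rightarrow> 'a set" where "verts G \<equiv> fst G"

abbreviation edges :: "'a graph \<Rightarrow> 'a set set" where "edges G \<equiv> snd G"

definition simple_graph :: "'a graph \<Rightarrow> bool" where
  "simple_graph G \<longleftrightarrow> finite (verts G) \<and> (\<forall>e\<in>edges G. e \<subseteq> verts G \<and> card e = 2)"

definition complete_graph :: "nat \<Rightarrow> nat graph" where
  "complete_graph n = ({..<n}, {e. e \<subseteq> {..<n} \<and> card e = 2})"

definition degree :: "'a graph \<Rightarrow> 'a \<Rightarrow> nat" where
  "degree G v = card {e \<in> edges G. v \<in> e}"

definition at_most_regular :: "nat \<Rightarrow> 'a graph \<Rightarrow> bool" where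
  "at_most_regular r G \<longleftrightarrow> (\<forall>v\<in>verts G. degree G v \<le> r)"

definition ordering :: "'a graph \<Rightarrow> ('a set \<Rightarrow> nat) \<Rightarrow> bool" where
  "ordering G l \<longleftrightarrow> bij_betw l (edges G) {..<card (edges G)}"

text \<open>The edges whose labels are \<open>i, i + 1, \<dots>, i + s - 1\<close> modulo the number of edges.\<close>

definition consecutive_edges :: "'a graph \<Rightarrow> ('a set \<Rightarrow> nat) \<Rightarrow> nat \<Rightarrow> nat \<Rightarrow> 'a set set" where
  "consecutive_edges G l i s =
     {e \<in> edges G. \<exists>j<s. l e = (i + j) mod card (edges G)}"

text \<open>The bound \<open>s \<le> card (edges G)\<close> is implicit in speaking of \<open>s\<close> (distinct) cyclically
  consecutive edges; without it there would be no largest \<open>s\<close> when \<open>G\<close> itself has maximum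
  degree at most \<open>r\<close>.\<close>

definition cms_ordering :: "nat \<Rightarrow> 'a graph \<Rightarrow> ('a set \<Rightarrow> nat) \<Rightarrow> nat" where
  "cms_ordering r G l =
     Max {s. s \<le> card (edges G) \<and>
             (\<forall>i<card (edges G). at_most_regular r (verts G, consecutive_edges G l i s))}"

definition cms :: "nat \<Rightarrow> 'a graph \<Rightarrow> nat" where
  "cms r G = Max {cms_ordering r G l | l. ordering G l}"

lemma simple_graph_complete_graph: "simple_graph (complete_graph n)"
  by (simp add: simple_graph_def complete_graph_def)

lemma simple_graph_finite_edges:
  assumes "simple_graph G"
  shows "finite (edges G)"
proof (rule finite_subset)
  show "edges G \<subseteq> Pow (verts G)" using assms by (auto simp: simple_graph_def)
  show "finite (Pow (verts G))" using assms by (simp add: simple_graph_def)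
qed

text \<open>Both maxima are taken over finite nonempty sets.\<close>

lemma cms_ordering_set:
  fixes G :: "'a graph" and r :: nat and l :: "'a set \<Rightarrow> nat"
  defines "S \<equiv> {s. s \<le> card (edges G) \<and>
             (\<forall>i<card (edges G). at_most_regular r (verts G, consecutive_edges G l i s))}"
  shows "finite S" and "0 \<in> S"
  by (auto simp: S_def at_most_regular_def degree_def consecutive_edges_def)

lemma cms_ordering_le: "cms_ordering r G l \<le> card (edges G)"
  unfolding cms_ordering_def using cms_ordering_set[of G r l] by (subst Max_le_iff) auto

lemma cms_set:
  assumes "simple_graph G"
  shows "finite {cms_ordering r G l | l. ordering G l}"
    and "{cms_ordering r G l | l. ordering G l} \<noteq> {}"
proof -
  show "finite {cms_ordering r G l | l. ordering G l}"
    by (rule finite_subset[of _ "{..card (edges G)}"]) (auto simp: cms_ordering_le)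
  have "\<exists>l. bij_betw l (edges G) {..<card (edges G)}"
    using ex_bij_betw_finite_nat[OF simple_graph_finite_edges[OF assms]]
    by (simp add: atLeast0LessThan)
  then show "{cms_ordering r G l | l. ordering G l} \<noteq> {}"
    by (auto simp: ordering_def)
qed

end

theory Submission imports Defs begin

text \<open>Write \<open>n = 2 * m + 1\<close> and \<open>r = 2 * k\<close>.

  Lower bound: let the vertices be the residues modulo \<open>2 * m\<close> and one extra vertex.  For
  \<open>c < m\<close>, the edges with endpoint sum \<open>c\<close> or \<open>2 * m - 1 - c\<close>, completed by two edges at the extra
  vertex, form a 2-factor.  List its \<open>n\<close> edges so that the edge of sum \<open>s\<close> through \<open>v\<close> is at
  the distance of \<open>2 * v\<close> from \<open>s\<close> modulo \<open>4 * m\<close>.  This is 1-Lipschitz in \<open>s\<close>, so passing from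
  \<open>c\<close> to \<open>c'\<close> with \<open>\<bar>c - c'\<bar> \<le> 2\<close> moves the edges at every vertex by at most two positions.
  Concatenate the blocks in an order in which blocks that are \<open>k\<close> apart cyclically satisfy this: on
  each orbit of the shift by \<open>k\<close>, run through an interval as \<open>0, 2, 4, \<dots>, 5, 3, 1\<close>.  Then the
  edges at a vertex split into two families with one member per block, and any two members \<open>k\<close>
  blocks apart are at least \<open>k * n - 2\<close> positions apart.\<close>

section \<open>The upper bound\<close>

lemma sum_incidences_eq:
  assumes "finite V" "finite W" "\<And>e. e \<in> W \<Longrightarrow> e \<subseteq> V \<and> card e = 2"
  shows "(\<Sum>v\<in>V. card {e \<in> W. v \<in> e}) = 2 * card W"
proof -
  have "(\<Sum>v\<in>V. card {e \<in> W. v \<in> e}) = (\<Sum>v\<in>V. \<Sum>e\<in>W. if v \<in> e then 1 else 0)"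
    using assms(2) by (intro sum.cong refl) (simp add: sum.If_cases Int_def)
  also have "\<dots> = (\<Sum>e\<in>W. \<Sum>v\<in>V. if v \<in> e then 1 else 0)"
    by (rule sum.swap)
  also have "\<dots> = (\<Sum>e\<in>W. 2)"
  proof (intro sum.cong refl)
    fix e assume "e \<in> W"
    then have "V \<inter> e = e" "card e = 2" using assms(3) by auto
    then show "(\<Sum>v\<in>V. if v \<in> e then 1 else 0) = (2::nat)"
      using assms(1) by (simp add: sum.If_cases)
  qed
  finally show ?thesis by simp
qed

lemma degree_mono:
  assumes "finite W'" "W \<subseteq> W'"
  shows "degree (V, W) v \<le> degree (V, W') v"
  unfolding degree_def using assms by (auto intro!: card_mono)

lemma card_edges_below:
  assumes "ordering G l" "t \<le> card (edges G)"
  shows "card {e \<in> edges G. l e < t} = t"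
proof -
  have l: "bij_betw l (edges G) {..<card (edges G)}" using assms(1) by (simp add: ordering_def)
  have "bij_betw l {e \<in> edges G. l e < t} {..<t}"
  proof (rule bij_betw_subset[OF l])
    show "l ` {e \<in> edges G. l e < t} = {..<t}"
    proof (intro equalityI subsetI)
      fix x assume "x \<in> {..<t}"
      moreover from this obtain e where "e \<in> edges G" "l e = x"
        using l assms(2) by (metis bij_betw_imp_surj_on imageE lessThan_iff less_le_trans)
      ultimately show "x \<in> l ` {e \<in> edges G. l e < t}" by auto
    qed auto
  qed auto
  then show ?thesis by (simp add: bij_betw_same_card)
qed

text \<open>A longer window would contain \<open>t\<close> consecutive edges forming an exactly \<open>r\<close>-regular graph;
  sliding that window by one step raises the degree of an endpoint of the new edge.\<close>

lemma cms_ordering_less: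
  fixes G :: "'a graph"
  assumes G: "simple_graph G" and l: "ordering G l"
    and t: "2 * t = r * card (verts G)" "0 < t" "t < card (edges G)"
  shows "cms_ordering r G l < t"
proof -
  define N where "N = card (edges G)"
  note fin = simple_graph_finite_edges[OF G]
  have bij: "bij_betw l (edges G) {..<N}" using l by (simp add: ordering_def N_def)
  have "s < t" if s: "s \<le> N"
    "\<forall>i<N. at_most_regular r (verts G, consecutive_edges G l i s)" for s
  proof (rule ccontr)
    assume "\<not> s < t"
    have win: "degree (verts G, W) v \<le> r"
      if "i < N" "W \<subseteq> consecutive_edges G l i t" "v \<in> verts G" for i W v
    proof -
      have "W \<subseteq> consecutive_edges G l i s"
      proof
        fix e assume "e \<in> W"
        then obtain j where "e \<in> edges G" "j < t" "l e = (i + j) mod card (edges G)"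
          using \<open>W \<subseteq> consecutive_edges G l i t\<close> by (auto simp: consecutive_edges_def)
        moreover from this have "j < s" using \<open>\<not> s < t\<close> by simp
        ultimately show "e \<in> consecutive_edges G l i s"
          unfolding consecutive_edges_def by blast
      qed
      moreover have "finite (consecutive_edges G l i s)"
        using fin by (auto simp: consecutive_edges_def)
      ultimately have "degree (verts G, W) v \<le> degree (verts G, consecutive_edges G l i s) v"
        by (intro degree_mono)
      also have "\<dots> \<le> r" using s(2) that by (auto simp: at_most_regular_def)
      finally show ?thesis .
    qed
    define W where "W = {e \<in> edges G. l e < t}"
    have W: "finite W" "card W = t"
      using fin card_edges_below[OF l, of t] t by (auto simp: W_def)
    have W0: "W \<subseteq> consecutive_edges G l 0 t"
      using t by (auto simp: W_def consecutive_edges_def)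
    have "(\<Sum>v\<in>verts G. degree (verts G, W) v) = 2 * card W"
      unfolding degree_def snd_conv
      using G W by (intro sum_incidences_eq) (auto simp: simple_graph_def W_def)
    then have sum: "(\<Sum>v\<in>verts G. degree (verts G, W) v) = (\<Sum>v\<in>verts G. r)"
      using t W by simp
    \<comment> \<open>The degrees average to \<open>r\<close> and none exceeds \<open>r\<close>, so
      all equal \<open>r\<close>.\<close>
    have reg: "degree (verts G, W) v = r" if "v \<in> verts G" for v
    proof (rule sum_mono_inv[OF sum _ that])
      show "degree (verts G, W) u \<le> r" if "u \<in> verts G" for u
        using win[OF _ W0 that] t by (simp add: N_def)
      show "finite (verts G)" using G by (simp add: simple_graph_def)
    qed
    obtain e0 where e0: "e0 \<in> edges G" "l e0 = 0"
      using bij t by (metis N_def bij_betw_imp_surj_on imageE lessThan_iff less_trans)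
    obtain e1 where e1: "e1 \<in> edges G" "l e1 = t"
      using bij t by (metis N_def bij_betw_imp_surj_on imageE lessThan_iff)
    have card2: "card e0 = 2" "card e1 = 2" "e1 \<subseteq> verts G"
      using G e0 e1 by (auto simp: simple_graph_def)
    \<comment> \<open>Containment would make these two-element sets equal, but the labels
      \<open>0\<close> and \<open>t\<close> differ. Sliding the window thus adds an edge at some
      \<open>v\<close> and removes none there.\<close>
    have "\<not> e1 \<subseteq> e0"
      using card2 e0 e1 t by (metis card.infinite card_subset_eq less_numeral_extra(3) zero_neq_numeral)
    then obtain v where v: "v \<in> e1" "v \<notin> e0" by auto
    have "insert e1 (W - {e0}) \<subseteq> consecutive_edges G l 1 t"
    proof
      fix e assume e: "e \<in> insert e1 (W - {e0})"
      have *: "e \<in> edges G" "0 < l e" "l e \<le> t"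
      proof (atomize (full), cases "e = e1")
        case False
        with e have "e \<in> edges G" "l e < t" "e \<noteq> e0" by (auto simp: W_def)
        moreover from this have "l e \<noteq> 0"
          using bij e0 by (metis bij_betw_imp_inj_on inj_onD)
        ultimately show "e \<in> edges G \<and> 0 < l e \<and> l e \<le> t" by simp
      qed (use e1 t in simp)
      then have "l e - 1 < t \<and> l e = (1 + (l e - 1)) mod card (edges G)"
        using t by auto
      with * show "e \<in> consecutive_edges G l 1 t"
        unfolding consecutive_edges_def by blast
    qed
    then have "degree (verts G, insert e1 (W - {e0})) v \<le> r"
      using v card2 t by (intro win[of 1]) (auto simp: N_def)
    moreover have "{e \<in> insert e1 (W - {e0}). v \<in> e} = insert e1 {e \<in> W. v \<in> e}"
      using v by auto
    moreover have "e1 \<notin> W" using e1 by (auto simp: W_def)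
    ultimately have "Suc (degree (verts G, W) v) \<le> r"
      using W by (simp add: degree_def)
    moreover have "degree (verts G, W) v = r" using reg v card2 by auto
    ultimately show False by simp
  qed
  then show ?thesis
    unfolding cms_ordering_def using cms_ordering_set[of G r l]
    by (subst Max_less_iff) (auto simp: N_def)
qed

section \<open>Arranging the blocks\<close>

definition zigzag :: "nat \<Rightarrow> nat \<Rightarrow> nat" where
  "zigzag L i = (if 2 * i < L then 2 * i else 2 * L - 1 - 2 * i)"

lemma bij_betw_zigzag: "bij_betw (zigzag L) {..<L} {..<L}"
proof -
  have "inj_on (zigzag L) {..<L}"
  proof (rule inj_onI)
    fix i j assume "i \<in> {..<L}" "j \<in> {..<L}" "zigzag L i = zigzag L j"
    then show "i = j"
      unfolding zigzag_def lessThan_iff by (auto split: if_splits) presburger+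
  qed
  moreover have "zigzag L ` {..<L} \<subseteq> {..<L}" by (auto simp: zigzag_def)
  ultimately show ?thesis by (simp add: bij_betw_def endo_inj_surj)
qed

text \<open>Both monotone runs move by two; the turn at the top and the cyclic return to
  \<open>0\<close> move by at most one.\<close>

lemma zigzag_step:
  assumes "i < L"
  shows "\<bar>int (zigzag L (Suc i mod L)) - int (zigzag L i)\<bar> \<le> 2"
proof (cases "Suc i = L")
  case True
  then show ?thesis by (auto simp: zigzag_def)
next
  case False
  with assms show ?thesis by (auto simp: zigzag_def)
qed

text \<open>Gives each of the \<open>g\<close> orbits its own interval of length \<open>L\<close>,
  traversed in the order \<open>z\<close>.\<close>

lemma bij_betw_mult_add:
  fixes z :: "nat \<Rightarrow> nat"
  assumes "bij_betw z {..<L} {..<L}"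
  shows "bij_betw (\<lambda>(h, i). h * L + z i) ({..<g} \<times> {..<L}) {..<g * L}"
proof -
  have z: "z i < L" if "i < L" for i using assms that by (auto simp: bij_betw_def)
  have "inj_on (\<lambda>(h, i). h * L + z i) ({..<g} \<times> {..<L})"
  proof (rule inj_onI, clarsimp)
    fix h i h' i' assume *: "i < L" "i' < L" "h * L + z i = h' * L + z i'"
    have "(h * L + z i) div L = h" using z[OF *(1)] by simp
    moreover have "(h' * L + z i') div L = h'" using z[OF *(2)] by simp
    ultimately have "h = h'" using *(3) by metis
    moreover from this have "i = i'" using assms * by (auto simp: bij_betw_def inj_on_def)
    ultimately show "h = h' \<and> i = i'" by simp
  qed
  moreover have "(\<lambda>(h, i). h * L + z i) ` ({..<g} \<times> {..<L}) \<subseteq> {..<g * L}"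
  proof clarsimp
    fix h i assume "h < g" "i < L"
    then have "h * L + z i < Suc h * L" "Suc h * L \<le> g * L"
      using z by (auto simp del: mult_Suc intro: mult_le_mono1) simp
    then show "h * L + z i < g * L" by linarith
  qed
  ultimately show ?thesis
    by (simp add: bij_betw_def card_image card_subset_eq)
qed

text \<open>For the shift by \<open>g * k'\<close>, the pair \<open>(h, i)\<close> names the
  \<open>i\<close>-th iterate in the orbit of \<open>h\<close>. The residue modulo \<open>g\<close>
  recovers \<open>h\<close>, and coprimality then recovers \<open>i\<close>.\<close>

lemma bij_betw_residue_orbits:
  fixes k' L g :: nat
  assumes "coprime k' L" "0 < L" "0 < g"
  shows "bij_betw (\<lambda>(h, i). (h + g * k' * i) mod (g * L)) ({..<g} \<times> {..<L}) {..<g * L}"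
proof -
  have "inj_on (\<lambda>(h, i). (h + g * k' * i) mod (g * L)) ({..<g} \<times> {..<L})"
  proof (rule inj_onI, clarsimp)
    fix h i h' i'
    assume *: "h < g" "h' < g" "i < L" "i' < L"
      "(h + g * k' * i) mod (g * L) = (h' + g * k' * i') mod (g * L)"
    have red: "(x + g * k' * j) mod (g * L) = g * (k' * j mod L) + x" if "x < g" for x j
      using that assms
      by (simp add: mod_mult2_eq mult.assoc)
    from * have eq: "g * (k' * i mod L) + h = g * (k' * i' mod L) + h'"
      by (simp add: red)
    have "h = h'" using arg_cong[OF eq, of "\<lambda>x. x mod g"] * by simp
    with eq have "k' * i mod L = k' * i' mod L" using assms by simp
    then have "int k' * int i mod int L = int k' * int i' mod int L"
      by (metis of_nat_mod of_nat_mult)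
    then have "int L dvd int k' * (int i - int i')"
      by (simp add: mod_eq_dvd_iff right_diff_distrib)
    then have "int L dvd int i - int i'"
      using assms(1) by (simp add: coprime_commute coprime_dvd_mult_right_iff)
    then have "i = i'" using * by (simp flip: mod_eq_dvd_iff)
    with \<open>h = h'\<close> show "h = h' \<and> i = i'" by simp
  qed
  moreover have "(\<lambda>(h, i). (h + g * k' * i) mod (g * L)) ` ({..<g} \<times> {..<L}) \<subseteq> {..<g * L}"
    using assms by auto
  ultimately show ?thesis
    by (simp add: bij_betw_def card_image card_subset_eq)
qed

lemma exists_bij_shift_close:
  fixes k m :: nat
  assumes "0 < m" "0 < k"
  shows "\<exists>c. bij_betw c {..<m} {..<m} \<and>
           (\<forall>b<m. \<bar>int (c ((b + k) mod m)) - int (c b)\<bar> \<le> 2)"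
proof -
  define g where "g = gcd k m"
  obtain k' L where kL: "k = g * k'" "m = g * L" "coprime k' L"
  proof -
    have "gcd k m \<noteq> 0" using assms by simp
    from gcd_coprime_exists[OF this] show thesis
      using that unfolding g_def by (metis mult.commute)
  qed
  have pos: "0 < L" "0 < g" using kL assms by auto
  define f where "f = (\<lambda>(h, i). (h + g * k' * i) mod (g * L))"
  define z where "z = (\<lambda>(h, i). h * L + zigzag L i)"
  let ?A = "{..<g} \<times> {..<L}"
  have f: "bij_betw f ?A {..<m}"
    unfolding f_def kL using bij_betw_residue_orbits[OF kL(3) pos] by simp
  have z: "bij_betw z ?A {..<m}"
    unfolding z_def kL by (rule bij_betw_mult_add[OF bij_betw_zigzag])
  \<comment> \<open>Orbit coordinates become interval positions, so a shift by \<open>k\<close> is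
    one cyclic step of \<open>zigzag\<close>.\<close>
  define c where "c = z \<circ> inv_into ?A f"
  have "bij_betw c {..<m} {..<m}"
    unfolding c_def using bij_betw_trans[OF bij_betw_inv_into[OF f] z] .
  moreover have cf: "c (f p) = z p" if "p \<in> ?A" for p
    using that f by (simp add: c_def bij_betw_inv_into_left)
  have "\<bar>int (c ((b + k) mod m)) - int (c b)\<bar> \<le> 2" if "b < m" for b
  proof -
    have "b \<in> f ` ?A" using f that by (simp add: bij_betw_def)
    then obtain h i where hi: "h < g" "i < L" "b = f (h, i)" by auto
    have "(b + k) mod m = (h + g * k' * Suc i) mod (g * L)"
      by (simp add: hi f_def kL mod_simps algebra_simps)
    also have "\<dots> = f (h, Suc i mod L)"
    proof (cases "Suc i = L")
      case True
      have "h + g * k' * Suc i = h + k' * (g * L)" by (simp add: True)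
      then have "(h + g * k' * Suc i) mod (g * L) = h mod (g * L)" by (metis mod_mult_self1)
      then show ?thesis using True by (simp add: f_def)
    next
      case False
      then show ?thesis using hi by (simp add: f_def)
    qed
    finally have "c ((b + k) mod m) = z (h, Suc i mod L)"
      using hi pos cf by simp
    moreover have "c b = z (h, i)" using hi cf by simp
    ultimately show ?thesis using zigzag_step[OF hi(2)] by (simp add: z_def)
  qed
  ultimately show ?thesis by blast
qed

section \<open>Counting in cyclic windows\<close>

text \<open>Unrolling the cycle makes the positions a strictly increasing sequence \<open>x\<close>
  whose terms \<open>k\<close> apart differ by at least \<open>k * n - 2\<close>, so a window of
  that length meets at most \<open>k\<close> of them.\<close>

lemma card_cyclic_window_le:
  fixes u :: "nat \<Rightarrow> nat"
  assumes m: "0 < m" and u: "\<And>b. b < m \<Longrightarrow> u b < n"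
    and step: "\<And>b. b < m \<Longrightarrow> u b \<le> u ((b + k) mod m) + 2"
  shows "card {b. b < m \<and> (\<exists>j<k * n - 2. n * b + u b = (i + j) mod (n * m))} \<le> k"
proof -
  define x where "x B = n * B + u (B mod m)" for B
  define D where "D = {B. i \<le> x B \<and> x B < i + (k * n - 2)}"
  have x_less: "x B < x B'" if "B < B'" for B B'
  proof -
    have "x B < n * Suc B" using u[of "B mod m"] m by (simp add: x_def)
    also have "\<dots> \<le> n * B'" using that by (intro mult_le_mono2) simp
    also have "\<dots> \<le> x B'" by (simp add: x_def)
    finally show ?thesis .
  qed
  have x_step: "x B + k * n \<le> x (B + k) + 2" for B
    using step[of "B mod m"] m by (simp add: x_def algebra_simps mod_simps)
  \<comment> \<open>For empty \<open>D\<close> the \<open>LEAST\<close> value is arbitrary and the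
    inclusion trivial. A member of \<open>D\<close> forces \<open>k * n > 2\<close>, so the
    subtraction is then exact.\<close>
  have D: "D \<subseteq> {B0..<B0 + k}" if "B0 = (LEAST B. B \<in> D)" for B0
  proof
    fix B assume B: "B \<in> D"
    then have "B0 \<in> D" "B0 \<le> B" using that by (auto intro: LeastI Least_le)
    moreover have "B < B0 + k"
    proof (rule ccontr)
      assume "\<not> B < B0 + k"
      then have "x (B0 + k) \<le> x B" using x_less by (cases "B = B0 + k") (auto simp: less_imp_le)
      then show False
        using x_step[of B0] B \<open>B0 \<in> D\<close> by (auto simp: D_def)
    qed
    ultimately show "B \<in> {B0..<B0 + k}" by simp
  qed
  have "{b. b < m \<and> (\<exists>j<k * n - 2. n * b + u b = (i + j) mod (n * m))} \<subseteq> (\<lambda>B. B mod m) ` D"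
  proof clarify
    fix b j assume b: "b < m" "j < k * n - 2" "n * b + u b = (i + j) mod (n * m)"
    \<comment> \<open>The quotient counts completed turns and lifts \<open>b\<close> to the copy of
      its block that contains \<open>i + j\<close>.\<close>
    define B where "B = m * ((i + j) div (n * m)) + b"
    have "B mod m = b" using b by (simp add: B_def)
    moreover have "x B = i + j"
    proof -
      have "x B = (n * m) * ((i + j) div (n * m)) + (n * b + u b)"
        using \<open>B mod m = b\<close> by (simp add: x_def B_def algebra_simps)
      then show ?thesis using b(3) by simp
    qed
    ultimately show "b \<in> (\<lambda>B. B mod m) ` D" using b by (force simp: D_def)
  qed
  then have "card {b. b < m \<and> (\<exists>j<k * n - 2. n * b + u b = (i + j) mod (n * m))}
      \<le> card ((\<lambda>B. B mod m) ` D)"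
    using D by (intro card_mono finite_imageI) (auto intro: finite_subset)
  also have "\<dots> \<le> card D" using D by (intro card_image_le) (auto intro: finite_subset)
  also have "\<dots> \<le> k" using card_mono[OF _ D] by simp
  finally show ?thesis .
qed

section \<open>The construction\<close>

text \<open>The offset, inside its block, of the edge through \<open>v\<close> whose endpoints have sum \<open>s\<close> modulo
  \<open>2 * m\<close>: the distance of \<open>2 * v - s\<close> to the nearest multiple of \<open>4 * m\<close>.\<close>

definition offset :: "nat \<Rightarrow> nat \<Rightarrow> nat \<Rightarrow> nat" where
  "offset m s v = nat (min \<bar>2 * int v - int s\<bar> (4 * int m - \<bar>2 * int v - int s\<bar>))"

lemma offset_le: "offset m s v \<le> 2 * m"
  unfolding offset_def by linarith

text \<open>One direction suffices: only a backward move brings the edges of a later block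
  closer.\<close>

lemma offset_close:
  assumes "s < 2 * m" "s' < 2 * m" "v < 2 * m" "\<bar>int s' - int s\<bar> \<le> 2"
  shows "offset m s v \<le> offset m s' v + 2"
  using assms unfolding offset_def by linarith

lemma int_offset:
  assumes "s < 2 * m" "v < 2 * m"
  shows "int (offset m s v) = min \<bar>2 * int v - int s\<bar> (4 * int m - \<bar>2 * int v - int s\<bar>)"
  using assms unfolding offset_def by linarith

text \<open>Both arguments of the minimum have the parity of \<open>s\<close>. The two sums of a
  block have opposite parities, so a position determines its sum.\<close>

lemma even_offset_iff:
  assumes "s < 2 * m" "v < 2 * m"
  shows "even (offset m s v) \<longleftrightarrow> even s"
proof -
  have "even (int (offset m s v)) \<longleftrightarrow> even (int s)"
    unfolding int_offset[OF assms] min_def by simp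
  then show ?thesis by simp
qed

text \<open>Equal distances mean that \<open>2 * v - s\<close> and \<open>2 * x - s\<close> agree up
  to sign modulo \<open>4 * m\<close>. The level sets are thus the orbits of the reflection sending
  \<open>v\<close> to \<open>s - v\<close> modulo \<open>2 * m\<close>.\<close>

lemma offset_eq_iff:
  assumes "s < 2 * m" "v < 2 * m" "x < 2 * m"
  shows "offset m s v = offset m s x \<longleftrightarrow> v = x \<or> v + x = s \<or> v + x = s + 2 * m"
proof
  assume "offset m s v = offset m s x"
  then have "int (offset m s v) = int (offset m s x)" by simp
  then show "v = x \<or> v + x = s \<or> v + x = s + 2 * m"
    using assms by (simp only: int_offset) linarith
next
  assume "v = x \<or> v + x = s \<or> v + x = s + 2 * m"
  then show "offset m s v = offset m s x" using assms unfolding offset_def by linarith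
qed

text \<open>Block \<open>c < m\<close> consists of the edges of sums \<open>c\<close> and \<open>2 * m - 1 - c\<close>, together with the two
  edges joining the extra vertex \<open>2 * m\<close> to the fixed points of the even one of these sums; the
  parity of the offset tells which sum is meant.\<close>

definition block_sum :: "nat \<Rightarrow> nat \<Rightarrow> nat \<Rightarrow> nat" where
  "block_sum m c q = (if even c = even q then c else 2 * m - 1 - c)"

definition block_edge :: "nat \<Rightarrow> nat \<Rightarrow> nat \<Rightarrow> nat set" where
  "block_edge m c q = {v. v < 2 * m \<and> offset m (block_sum m c q) v = q} \<union>
     (if q = 0 \<or> q = 2 * m then {2 * m} else {})"

text \<open>The block index is the smaller of \<open>s\<close> and
  \<open>2 * m - 1 - s\<close>.\<close>

lemma block_sum_exists:
  assumes "s < 2 * m" "even q \<longleftrightarrow> even s"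
  obtains c where "c < m" "block_sum m c q = s"
proof (cases "s < m")
  case True
  with assms that[of s] show ?thesis by (simp add: block_sum_def)
next
  case False
  with assms that[of "2 * m - 1 - s"] show ?thesis by (auto simp: block_sum_def)
qed

lemma pair_is_block_edge:
  assumes "x < y" "y \<le> 2 * m"
  shows "\<exists>c<m. \<exists>q\<le>2 * m. block_edge m c q = {x, y}"
proof (cases "y = 2 * m")
  case False
  define s where "s = (if x + y < 2 * m then x + y else x + y - 2 * m)"
  define q where "q = offset m s x"
  have s_cases: "s = x + y \<or> s + 2 * m = x + y" and s: "s < 2 * m"
    using assms False by (auto simp: s_def)
  have "even q \<longleftrightarrow> even s" using s assms by (simp add: q_def even_offset_iff)
  with s obtain c where c: "c < m" "block_sum m c q = s" by (rule block_sum_exists)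
  \<comment> \<open>The extreme offsets occur only at fixed points of the reflection, which would
    force \<open>x = y\<close>.\<close>
  have "q \<noteq> 0 \<and> q \<noteq> 2 * m"
    using assms False s_cases unfolding q_def offset_def by (intro conjI notI) linarith+
  then have "block_edge m c q = {v. v < 2 * m \<and> offset m s v = offset m s x}"
    using c by (simp add: block_edge_def q_def)
  also have "\<dots> = {v. v < 2 * m \<and> (v = x \<or> v + x = s \<or> v + x = s + 2 * m)}"
    using s assms by (auto simp: offset_eq_iff)
  also have "\<dots> = {x, y}" using assms False by (auto simp: s_def)
  finally have "block_edge m c q = {x, y}" .
  moreover have "q \<le> 2 * m" unfolding q_def by (rule offset_le)
  ultimately show ?thesis using c by blast
next
  case True
  \<comment> \<open>Twice \<open>x\<close> modulo \<open>2 * m\<close>: the reflection then fixes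
    \<open>x\<close>, leaving room for the extra vertex.\<close>
  define s where "s = (if x < m then 2 * x else 2 * x - 2 * m)"
  define q where "q = offset m s x"
  have s_cases: "x < m \<and> s = 2 * x \<or> m \<le> x \<and> s + 2 * m = 2 * x" and s: "s < 2 * m"
    using assms True by (auto simp: s_def)
  have "even q \<longleftrightarrow> even s" using s assms by (simp add: q_def even_offset_iff)
  with s obtain c where c: "c < m" "block_sum m c q = s" by (rule block_sum_exists)
  have "q = 0 \<or> q = 2 * m"
    using assms True s_cases unfolding q_def offset_def by linarith
  then have "block_edge m c q = {v. v < 2 * m \<and> offset m s v = offset m s x} \<union> {2 * m}"
    using c by (simp add: block_edge_def q_def)
  also have "\<dots> = {v. v < 2 * m \<and> (v = x \<or> v + x = s \<or> v + x = s + 2 * m)} \<union> {2 * m}"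
    using s assms by (auto simp: offset_eq_iff)
  also have "\<dots> = {x, y}" using assms True by (auto simp: s_def split: if_splits)
  finally have "block_edge m c q = {x, y}" .
  moreover have "q \<le> 2 * m" unfolding q_def by (rule offset_le)
  ultimately show ?thesis using c by blast
qed

lemma card_edges_complete_graph: "card (edges (complete_graph n)) = n * (n - 1) div 2"
  using n_subsets[of "{..<n}" 2] by (simp add: complete_graph_def choose_two)

text \<open>There are as many positions as edges, so covering every edge already makes
  \<open>F\<close> a bijection onto the edges.\<close>

lemma exists_block_ordering:
  fixes m :: nat and c :: "nat \<Rightarrow> nat"
  assumes c: "bij_betw c {..<m} {..<m}"
  defines "n \<equiv> 2 * m + 1"
  obtains l where "ordering (complete_graph n) l"
    "\<And>e. e \<in> edges (complete_graph n) \<Longrightarrow> e = block_edge m (c (l e div n)) (l e mod n)"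
proof -
  let ?E = "edges (complete_graph n)"
  define F where "F T = block_edge m (c (T div n)) (T mod n)" for T
  have card: "card ?E = n * m"
    by (simp add: card_edges_complete_graph n_def)
  have sub: "?E \<subseteq> F ` {..<n * m}"
  proof
    fix e assume "e \<in> ?E"
    then have "e \<subseteq> {..<n}" "card e = 2" by (auto simp: complete_graph_def)
    then obtain x y where "e = {x, y}" "x < y" "y \<le> 2 * m"
      unfolding n_def
      by (metis Suc_eq_plus1 card_2_iff doubleton_eq_iff insert_subset less_Suc_eq_le
          lessThan_iff linorder_neqE_nat)
    then obtain d q where d: "d < m" "q \<le> 2 * m" "block_edge m d q = e"
      using pair_is_block_edge by metis
    then have "d \<in> c ` {..<m}" using c by (simp add: bij_betw_def)
    then obtain b where b: "b < m" "c b = d" by auto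
    have q: "q < n" using d by (simp add: n_def)
    then have "n * b + q < n * Suc b" by simp
    also have "\<dots> \<le> n * m" using b by (intro mult_le_mono2) simp
    finally have "n * b + q < n * m" .
    moreover have "F (n * b + q) = e" using b d q by (simp add: F_def)
    ultimately show "e \<in> F ` {..<n * m}" by blast
  qed
  have le: "card (F ` {..<n * m}) \<le> card ?E" using card_image_le[of "{..<n * m}" F] card by simp
  then have im: "F ` {..<n * m} = ?E" using card_seteq[OF _ sub] by simp
  then have "inj_on F {..<n * m}" using card by (intro eq_card_imp_inj_on) auto
  then have F: "bij_betw F {..<n * m} ?E" using im by (simp add: bij_betw_def)
  show thesis
  proof
    show "ordering (complete_graph n) (inv_into {..<n * m} F)"
      using bij_betw_inv_into[OF F] card by (simp add: ordering_def)
    show "e = block_edge m (c (inv_into {..<n * m} F e div n)) (inv_into {..<n * m} F e mod n)"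
      if "e \<in> ?E" for e
      using bij_betw_inv_into_right[OF F that] by (simp add: F_def)
  qed
qed

lemma block_ordering_regular:
  fixes m k :: nat
  defines "n \<equiv> 2 * m + 1"
  assumes m: "0 < m" and c: "bij_betw c {..<m} {..<m}"
    and close: "\<And>b. b < m \<Longrightarrow> \<bar>int (c ((b + k) mod m)) - int (c b)\<bar> \<le> 2"
    and l: "ordering (complete_graph n) l"
    and edge: "\<And>e. e \<in> edges (complete_graph n) \<Longrightarrow>
      e = block_edge m (c (l e div n)) (l e mod n)"
  shows "at_most_regular (2 * k)
    (verts (complete_graph n), consecutive_edges (complete_graph n) l i (k * n - 2))"
  unfolding at_most_regular_def
proof
  let ?G = "complete_graph n"
  let ?W = "consecutive_edges ?G l i (k * n - 2)"
  fix v assume "v \<in> verts (verts ?G, ?W)"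
  then have v: "v \<le> 2 * m" by (auto simp: complete_graph_def n_def)
  have card: "card (edges ?G) = n * m"
    by (simp add: card_edges_complete_graph n_def)
  have c_less: "c b < m" if "b < m" for b using c that by (auto simp: bij_betw_def)
  \<comment> \<open>The possible positions of the edges at \<open>v\<close> in block
    \<open>b\<close>: one for each sum if \<open>v < 2 * m\<close>, the first and the last for the
    extra vertex.\<close>
  define u where "u b = (if v < 2 * m then offset m (c b) v else 0)" for b
  define w where "w b = (if v < 2 * m then offset m (2 * m - 1 - c b) v else 2 * m)" for b
  have u: "u b \<le> u ((b + k) mod m) + 2" and w: "w b \<le> w ((b + k) mod m) + 2" if "b < m" for b
    using close[OF that] c_less[OF that] c_less[of "(b + k) mod m"] m offset_close[of _ m _ v]
    by (simp_all add: u_def w_def)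
  have uw_less: "u b < n" "w b < n" for b
    using offset_le by (auto simp: u_def w_def n_def less_Suc_eq_le)
  define S where "S f = {b. b < m \<and> (\<exists>j<k * n - 2. n * b + f b = (i + j) mod (n * m))}"
    for f :: "nat \<Rightarrow> nat"
  have S: "finite (S f)" for f by (simp add: S_def)
  have "l ` {e \<in> ?W. v \<in> e} \<subseteq> (\<lambda>b. n * b + u b) ` S u \<union> (\<lambda>b. n * b + w b) ` S w"
  proof clarify
    fix e assume e: "e \<in> ?W" "v \<in> e" "l e \<notin> (\<lambda>b. n * b + w b) ` S w"
    define b where "b = l e div n"
    have eG: "e \<in> edges ?G" and j: "\<exists>j<k * n - 2. l e = (i + j) mod (n * m)"
      using e(1) card by (auto simp: consecutive_edges_def)
    have "l e < n * m" using l eG card by (auto simp: ordering_def bij_betw_def)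
    then have b: "b < m" by (simp add: b_def less_mult_imp_div_less mult.commute)
    have le: "l e = n * b + l e mod n" by (simp add: b_def)
    have "v \<in> block_edge m (c b) (l e mod n)" using edge[OF eG] e(2) by (simp add: b_def)
    then have "l e mod n = u b \<or> l e mod n = w b"
      by (auto simp: block_edge_def block_sum_def u_def w_def split: if_splits)
    then have "l e = n * b + u b \<or> l e = n * b + w b" using le by metis
    moreover have "l e \<in> (\<lambda>b. n * b + f b) ` S f" if "l e = n * b + f b" for f
    proof -
      have "b \<in> S f" using b j that by (simp add: S_def)
      then show ?thesis unfolding that by (rule imageI)
    qed
    ultimately show "l e \<in> (\<lambda>b. n * b + u b) ` S u" using e(3) by blast
  qed
  then have "card (l ` {e \<in> ?W. v \<in> e}) \<le>
      card ((\<lambda>b. n * b + u b) ` S u \<union> (\<lambda>b. n * b + w b) ` S w)"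
    using S by (intro card_mono) auto
  also have "\<dots> \<le> card ((\<lambda>b. n * b + u b) ` S u) + card ((\<lambda>b. n * b + w b) ` S w)"
    by (rule card_Un_le)
  also have "\<dots> \<le> card (S u) + card (S w)" using S by (intro add_mono card_image_le)
  also have "\<dots> \<le> k + k"
    unfolding S_def using u w uw_less m by (intro add_mono card_cyclic_window_le) auto
  also have "card (l ` {e \<in> ?W. v \<in> e}) = card {e \<in> ?W. v \<in> e}"
    using l by (intro card_image)
      (auto simp: ordering_def bij_betw_def consecutive_edges_def intro: inj_on_subset)
  finally show "degree (verts ?G, ?W) v \<le> 2 * k" by (simp add: degree_def)
qed

section \<open>The two bounds for complete graphs of odd order\<close>

lemma cms_complete_graph_ge:
  assumes "0 < k" "k < m"
  shows "k * (2 * m + 1) - 2 \<le> cms (2 * k) (complete_graph (2 * m + 1))"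
proof -
  let ?n = "2 * m + 1"
  let ?G = "complete_graph ?n"
  have m: "0 < m" using assms by simp
  obtain c where c: "bij_betw c {..<m} {..<m}"
    "\<And>b. b < m \<Longrightarrow> \<bar>int (c ((b + k) mod m)) - int (c b)\<bar> \<le> 2"
    using exists_bij_shift_close[of m k] assms m by blast
  obtain l where l: "ordering ?G l"
    "\<And>e. e \<in> edges ?G \<Longrightarrow> e = block_edge m (c (l e div ?n)) (l e mod ?n)"
    using exists_block_ordering[OF c(1)] by blast
  have "k * ?n - 2 \<le> m * ?n"
    using mult_le_mono1[of k m ?n] assms by linarith
  then have "k * ?n - 2 \<le> card (edges ?G)"
    by (simp add: card_edges_complete_graph algebra_simps)
  then have "k * ?n - 2 \<le> cms_ordering (2 * k) ?G l"
    unfolding cms_ordering_def using cms_ordering_set(1) block_ordering_regular[OF m c l]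
    by (intro Max_ge) auto
  also have "\<dots> \<le> cms (2 * k) ?G"
    unfolding cms_def using cms_set(1)[OF simple_graph_complete_graph] l(1)
    by (intro Max_ge) auto
  finally show ?thesis .
qed

lemma cms_complete_graph_less:
  assumes "0 < k" "k < m"
  shows "cms (2 * k) (complete_graph (2 * m + 1)) < k * (2 * m + 1)"
proof -
  let ?n = "2 * m + 1"
  let ?G = "complete_graph ?n"
  \<comment> \<open>Since \<open>k < m\<close>, a window of \<open>k * ?n\<close> edges leaves an
    edge outside, into which it can slide.\<close>
  have "k * ?n < m * ?n" using assms by (intro mult_strict_right_mono) auto
  then have "k * ?n < card (edges ?G)"
    by (simp add: card_edges_complete_graph algebra_simps)
  then have "cms_ordering (2 * k) ?G l < k * ?n" if "ordering ?G l" for l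
    using assms that
    by (intro cms_ordering_less simple_graph_complete_graph) (auto simp: complete_graph_def)
  then show ?thesis
    unfolding cms_def using cms_set[OF simple_graph_complete_graph, of "2 * k" ?n]
    by (subst Max_less_iff) auto
qed

theorem theorem6:
  fixes n r :: nat
  assumes "n \<ge> 3" and "1 \<le> r" and "r \<le> n - 2" and "odd n" and "even r"
  shows "\<lfloor>(real r * real n - 1) / 2\<rfloor> - 1 \<le> int (cms r (complete_graph n)) \<and>
         int (cms r (complete_graph n)) \<le> \<lfloor>(real r * real n - 1) / 2\<rfloor>"
proof -
  obtain k m where km: "r = 2 * k" "n = 2 * m + 1"
    using assms by (meson evenE oddE)
  have k: "0 < k" "k < m" using assms km by auto
  \<comment> \<open>As \<open>r = 2 * k\<close>, the fraction is \<open>k * n - 1/2\<close>.\<close>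
  have "\<lfloor>(real r * real n - 1) / 2\<rfloor> = int (k * n) - 1"
    by (rule floor_unique) (auto simp: km(1) field_simps)
  moreover have "k * n - 2 \<le> cms r (complete_graph n)" "cms r (complete_graph n) < k * n"
    using cms_complete_graph_ge[OF k] cms_complete_graph_less[OF k] by (simp_all add: km)
  ultimately show ?thesis by linarith
qed

end
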